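(* Let $G=(V,E)$ be a graph with maximum degree $\Delta$, let $\varepsilon>0$ and $\lambda>0$. Then \[ \mathbb{E}_{M\sim\mu_\lambda}[|M|]\ \ge\ \frac{(1-\varepsilon/2)\lambda}{\lambda+(4\Delta)^{2\varepsilon^{-1}}}\cdot\nu(G). \] In particular, if $\lambda\ge 2\varepsilon^{-1}(4\Delta)^{2\varepsilon^{-1}}$, then \[ \mathbb{E}_{M\sim\mu_\lambda}[|M|]\ \ge\ \frac{1-\varepsilon/2}{1+\varepsilon/2}\,\nu(G)\ \ge\ (1-\varepsilon)\nu(G). \]
   Context: For a graph $G=(V,E)$ and $\lambda>0$, the Gibbs distribution $\mu_\lambda$ on the set $\mathcal M(G)$ of matchings of $G$ is $\mu_\lambda(M)=\lambda^{|M|}/Z$ with $Z=\sum_{M'\in\mathcal M(G)}\lambda^{|M'|}$. $\nu(G)$ denotes the maximum size of a matching of $G$. *)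

theory Defs
  imports "HOL-Probability.Probability_Mass_Function"
begin

definition simple_graph :: "'a set \<Rightarrow> 'a set set \<Rightarrow> bool" where
  "simple_graph V E \<longleftrightarrow> finite V \<and> (\<forall>e\<in>E. e \<subseteq> V \<and> card e = 2)"

definition vertex_degree :: "'a set set \<Rightarrow> 'a \<Rightarrow> nat" where
  "vertex_degree E v = card {e \<in> E. v \<in> e}"

text \<open>Inserting 0 only matters for the graph without vertices.\<close>
definition max_degree :: "'a set \<Rightarrow> 'a set set \<Rightarrow> nat" where
  "max_degree V E = Max (insert 0 (vertex_degree E ` V))"

definition matchings :: "'a set set \<Rightarrow> 'a set set set" where
  "matchings E = {M. M \<subseteq> E \<and> disjoint M}"

definition matching_number :: "'a set set \<Rightarrow> nat" where
  "matching_number E = Max (card ` matchings E)"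

definition partition_function :: "'a set set \<Rightarrow> real \<Rightarrow> real" where
  "partition_function E l = (\<Sum>M\<in>matchings E. l ^ card M)"

text \<open>
  The value of \<^const>\<open>embed_pmf\<close> is meaningful only if its argument is a probability
  mass function; \<open>pmf_gibbs\<close> below shows that this holds for every finite edge set
  and every positive fugacity.
\<close>
definition gibbs :: "'a set set \<Rightarrow> real \<Rightarrow> 'a set set pmf" where
  "gibbs E l =
     embed_pmf (\<lambda>M. if M \<in> matchings E then l ^ card M / partition_function E l else 0)"

lemma simple_graph_finite_edges:
  assumes "simple_graph V E"
  shows "finite E"
  using assms by (auto simp: simple_graph_def intro: finite_subset[of E "Pow V"])

lemma finite_matchings:
  assumes "finite E"
  shows "finite (matchings E)"
  using assms by (auto simp: matchings_def)

lemma empty_in_matchings: "{} \<in> matchings E"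
  by (simp add: matchings_def)

lemma partition_function_pos:
  assumes "finite E" and "l > 0"
  shows "partition_function E l > 0"
  unfolding partition_function_def
  using assms finite_matchings empty_in_matchings by (intro sum_pos) auto

lemma pmf_gibbs:
  assumes "finite E" and "l > 0"
  shows "pmf (gibbs E l) M =
    (if M \<in> matchings E then l ^ card M / partition_function E l else 0)"
proof -
  let ?f = "\<lambda>M. if M \<in> matchings E then l ^ card M / partition_function E l else 0"
  note pos = partition_function_pos[OF assms] and fin = finite_matchings[OF assms(1)]
  have nonneg: "0 \<le> ?f M" for M
    using assms(2) pos by simp
  have "(\<integral>\<^sup>+M. ennreal (?f M) \<partial>count_space UNIV) = (\<Sum>M\<in>matchings E. ennreal (?f M))"
    by (subst nn_integral_count_space'[OF fin]) auto
  also have "\<dots> = ennreal (\<Sum>M\<in>matchings E. ?f M)"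
    by (rule sum_ennreal) (rule nonneg)
  also have "(\<Sum>M\<in>matchings E. ?f M) = (\<Sum>M\<in>matchings E. l ^ card M) / partition_function E l"
    by (simp add: sum_divide_distrib)
  also have "\<dots> = 1"
    using pos by (simp add: partition_function_def)
  finally show ?thesis
    unfolding gibbs_def using nonneg by (subst pmf_embed_pmf) auto
qed

end

theory Submission
  imports Defs "HOL-Computational_Algebra.Fundamental_Theorem_Algebra"
begin

text \<open>
  By the Heilmann--Lieb theorem the partition function factors as \<open>c (l + r\<^sub>1) \<dots> (l + r\<^sub>\<nu>)\<close> with
  all \<open>r\<^sub>i > 0\<close>, so that its logarithmic derivative gives the expected size \<open>\<Sum>\<^sub>i l / (l + r\<^sub>i)\<close>.
  It therefore suffices that at most \<open>\<epsilon>\<nu>/2\<close> of the \<open>r\<^sub>i\<close> exceed \<open>C = (4\<Delta>) powr (2/\<epsilon>)\<close>.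
  The leading coefficient \<open>c\<close> counts the maximum matchings, hence \<open>\<Prod>\<^sub>i 1 / r\<^sub>i = c \<ge> 1\<close>, and the
  coefficient of \<open>l\<close> is \<open>\<Sum>\<^sub>i 1 / r\<^sub>i = |E| \<le> 2\<Delta>\<nu>\<close>. The second fact bounds the product of the large
  factors \<open>1 / r\<^sub>i\<close> by \<open>(4\<Delta>)^\<nu>\<close>, and more than \<open>\<epsilon>\<nu>/2\<close> factors below \<open>1 / C\<close> would make the
  whole product smaller than 1.
\<close>

section \<open>Vertex recursion for the matching polynomial\<close>

text \<open>Polymorphic because zeros are located over \<open>complex\<close>, whereas the partition
  function is the \<open>real\<close> instance.\<close>

definition matching_sum :: "'a set set \<Rightarrow> 'b \<Rightarrow> 'b::comm_semiring_1" where
  "matching_sum E z = (\<Sum>M\<in>matchings E. z ^ card M)"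

definition del_vertex :: "'a \<Rightarrow> 'a set set \<Rightarrow> 'a set set" where
  "del_vertex v E = {e \<in> E. v \<notin> e}"

lemma del_vertex_subset: "del_vertex v E \<subseteq> E"
  by (auto simp: del_vertex_def)

text \<open>Nonemptiness of \<open>e\<close> keeps \<open>e\<close> itself out of the smaller edge
  set, so that removing \<open>e\<close> undoes the insertion.\<close>

lemma matching_edge_bij:
  assumes "finite E" and "e \<in> E" and "e \<noteq> {}"
  shows "bij_betw (insert e) (matchings {f \<in> E. f \<inter> e = {}}) {M \<in> matchings E. e \<in> M}"
proof (rule bij_betwI[where g = "\<lambda>M. M - {e}"])
  show "insert e \<in> matchings {f \<in> E. f \<inter> e = {}} \<rightarrow> {M \<in> matchings E. e \<in> M}"
    using assms by (fastforce simp: matchings_def disjoint_def)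
  show "(\<lambda>M. M - {e}) \<in> {M \<in> matchings E. e \<in> M} \<rightarrow> matchings {f \<in> E. f \<inter> e = {}}"
    by (auto simp: matchings_def disjoint_def)
  show "insert e M - {e} = M" if "M \<in> matchings {f \<in> E. f \<inter> e = {}}" for M
    using that assms by (auto simp: matchings_def)
qed auto

text \<open>At most one edge of a matching contains \<open>v\<close>. Matchings without such an edge
  give the first summand; those containing a given \<open>e\<close> at \<open>v\<close> arise from
  matchings of the edges disjoint from \<open>e\<close> by adding one edge, hence one factor
  \<open>z\<close>.\<close>

lemma matching_sum_rec:
  fixes z :: "'b::comm_semiring_1"
  assumes fin: "finite E" and "\<And>e. e \<in> E \<Longrightarrow> e \<noteq> {}"
  shows "matching_sum E z = matching_sum (del_vertex v E) z +
    (\<Sum>e\<in>{e \<in> E. v \<in> e}. z * matching_sum {f \<in> E. f \<inter> e = {}} z)"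
proof -
  let ?N = "{e \<in> E. v \<in> e}"
  let ?A = "\<lambda>e. {M \<in> matchings E. e \<in> M}"
  have split: "matchings E = matchings (del_vertex v E) \<union> (\<Union>e\<in>?N. ?A e)"
    by (auto simp: matchings_def del_vertex_def)
  have finA: "finite (?A e)" for e
    using finite_matchings[OF fin] by simp
  have "matching_sum E z = (\<Sum>M\<in>matchings (del_vertex v E). z ^ card M)
      + (\<Sum>M\<in>(\<Union>e\<in>?N. ?A e). z ^ card M)"
    unfolding matching_sum_def
  proof (subst split, rule sum.union_disjoint)
    show "finite (matchings (del_vertex v E))"
      by (rule finite_matchings[OF finite_subset[OF del_vertex_subset fin]])
    show "finite (\<Union>e\<in>?N. ?A e)"
      using fin finA by simp
    show "matchings (del_vertex v E) \<inter> (\<Union>e\<in>?N. ?A e) = {}"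
      by (auto simp: matchings_def del_vertex_def)
  qed
  also have "(\<Sum>M\<in>(\<Union>e\<in>?N. ?A e). z ^ card M) = (\<Sum>e\<in>?N. \<Sum>M\<in>?A e. z ^ card M)"
  proof (rule sum.UNION_disjoint)
    show "\<forall>e\<in>?N. \<forall>f\<in>?N. e \<noteq> f \<longrightarrow> ?A e \<inter> ?A f = {}"
      unfolding matchings_def disjoint_def by blast
  qed (use fin finA in auto)
  also have "\<dots> = (\<Sum>e\<in>?N. z * matching_sum {f \<in> E. f \<inter> e = {}} z)"
  proof (rule sum.cong[OF refl])
    fix e assume e: "e \<in> ?N"
    have "(\<Sum>M\<in>?A e. z ^ card M)
        = (\<Sum>M\<in>matchings {f \<in> E. f \<inter> e = {}}. z ^ card (insert e M))"
      by (rule sum.reindex_bij_betw[symmetric], rule matching_edge_bij) (use e assms in auto)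
    also have "\<dots> = (\<Sum>M\<in>matchings {f \<in> E. f \<inter> e = {}}. z * z ^ card M)"
    proof (rule sum.cong[OF refl])
      fix M assume M: "M \<in> matchings {f \<in> E. f \<inter> e = {}}"
      then have "M \<subseteq> E" "e \<notin> M"
        using e assms(2) by (auto simp: matchings_def)
      then show "z ^ card (insert e M) = z * z ^ card M"
        using finite_subset[OF _ fin] by simp
    qed
    finally show "(\<Sum>M\<in>?A e. z ^ card M) = z * matching_sum {f \<in> E. f \<inter> e = {}} z"
      by (simp add: matching_sum_def sum_distrib_left)
  qed
  finally show ?thesis
    by (simp add: matching_sum_def)
qed

lemma matching_sum_0:
  assumes "finite E"
  shows "matching_sum E 0 = 1"
proof -
  have "matching_sum E 0 = (\<Sum>M\<in>matchings E. if M = {} then 1 else 0)"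
    unfolding matching_sum_def using assms
    by (intro sum.cong) (auto simp: matchings_def power_0_left dest: finite_subset)
  then show ?thesis
    using finite_matchings[OF assms] empty_in_matchings[of E] by simp
qed

section \<open>Location of the zeros (Heilmann-Lieb)\<close>

lemma Re_inverse_pos:
  assumes "Re z > 0"
  shows "Re (inverse z) > 0"
  using assms by (simp add: add_pos_nonneg)

text \<open>
  The quantity \<open>Z(E) / (w Z(E - v))\<close>, with \<open>Z\<close> taken at \<open>w\<^sup>2\<close>, equals \<open>1 / w\<close> plus the sum of the
  reciprocals of the same quantities for the pairs \<open>(E - v, u)\<close>, where \<open>u\<close> runs through the
  neighbours of \<open>v\<close>; the right half-plane is closed under sums and reciprocals.
\<close>
lemma matching_sum_half_plane:
  fixes E :: "'a set set" and w :: complex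
  assumes "finite E" and "\<And>e. e \<in> E \<Longrightarrow> card e = 2" and w: "Re w > 0"
  shows "matching_sum E (w\<^sup>2) \<noteq> 0 \<and>
    (\<forall>v. Re (matching_sum E (w\<^sup>2) / (w * matching_sum (del_vertex v E) (w\<^sup>2))) > 0)"
  using assms(1,2)
proof (induction "card E" arbitrary: E rule: less_induct)
  case less
  let ?Z = "\<lambda>E :: 'a set set. matching_sum E (w\<^sup>2)"
  have w0: "w \<noteq> 0" and iw: "Re (1 / w) > 0"
    using w Re_inverse_pos[OF w] by (auto simp: inverse_eq_divide simp del: inverse_complex.sel)
  have covered: "Re (?Z E / (w * ?Z (del_vertex v E))) > 0" if v: "\<exists>e\<in>E. v \<in> e" for v
  proof -
    let ?D = "del_vertex v E"
    have sub: "?D \<subset> E"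
      using v by (auto simp: del_vertex_def)
    have IH: "?Z ?D \<noteq> 0" "\<And>u. Re (?Z ?D / (w * ?Z (del_vertex u ?D))) > 0"
      using less.hyps[of ?D] psubset_card_mono[OF less.prems(1) sub] sub less.prems
        finite_subset[of ?D E] by auto
    \<comment> \<open>The recursion at \<open>w\<^sup>2\<close>, divided by
      \<open>w * ?Z ?D\<close>; each edge term keeps one factor \<open>w\<close>.\<close>
    have "?Z E / (w * ?Z ?D) = 1 / w + (\<Sum>e\<in>{e \<in> E. v \<in> e}. w * ?Z {f \<in> E. f \<inter> e = {}} / ?Z ?D)"
      using matching_sum_rec[of E "w\<^sup>2" v] less.prems IH(1) w0
      by (force simp: add_divide_distrib sum_divide_distrib power2_eq_square)
    moreover have "Re (w * ?Z {f \<in> E. f \<inter> e = {}} / ?Z ?D) > 0" if e: "e \<in> E" "v \<in> e" for e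
    proof -
      obtain u where "e = {u, v}"
        using less.prems(2)[OF e(1)] e(2) by (auto simp: card_2_iff)
      \<comment> \<open>Avoiding both ends of \<open>e\<close> means deleting \<open>v\<close> and
        then \<open>u\<close>, so the edge term is the reciprocal of a ratio covered by
        \<open>IH\<close>.\<close>
      then have "{f \<in> E. f \<inter> e = {}} = del_vertex u ?D"
        by (auto simp: del_vertex_def)
      then show ?thesis
        using Re_inverse_pos[OF IH(2)[of u]] by (simp del: inverse_complex.sel)
    qed
    ultimately show ?thesis
      using iw unfolding plus_complex.sel Re_sum
      by (metis (no_types, lifting) Re_sum add_pos_nonneg less_imp_le mem_Collect_eq
          plus_complex.sel(1) sum_nonneg)
  qed
  \<comment> \<open>A vanishing numerator would make the ratio at a covered vertex 0. At an
    uncovered vertex the ratio is \<open>1 / w\<close>, but only once nonvanishing is known; hence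
    this order.\<close>
  have nz: "?Z E \<noteq> 0"
  proof (cases "E = {}")
    case True
    then show ?thesis
      by (simp add: matching_sum_def matchings_def)
  next
    case False
    then obtain e where "e \<in> E" by auto
    moreover from this obtain v where "v \<in> e"
      using less.prems(2) by fastforce
    ultimately have "Re (?Z E / (w * ?Z (del_vertex v E))) > 0"
      using covered by blast
    then show ?thesis
      by force
  qed
  moreover have "Re (?Z E / (w * ?Z (del_vertex v E))) > 0" for v
  proof (cases "\<exists>e\<in>E. v \<in> e")
    case False
    then have "del_vertex v E = E"
      by (auto simp: del_vertex_def)
    then show ?thesis
      using nz iw by simp
  qed (rule covered)
  ultimately show ?case by blast
qed

text \<open>The principal square root \<open>w\<close> of a zero has nonnegative real part, and
  \<open>matching_sum_half_plane\<close> excludes a positive one. So \<open>w\<close> is purely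
  imaginary and its square is real and at most 0; the constant term 1 excludes 0.\<close>

lemma matching_sum_root:
  fixes z :: complex
  assumes "finite E" and "\<And>e. e \<in> E \<Longrightarrow> card e = 2" and "matching_sum E z = 0"
  shows "Im z = 0" and "Re z < 0"
proof -
  define w where "w = csqrt z"
  have z: "z = w\<^sup>2"
    by (simp add: w_def)
  have "\<not> Re w > 0"
    using matching_sum_half_plane[of E w] assms by (auto simp: z)
  then have "Re w = 0"
    using csqrt_principal[of z] by (auto simp flip: w_def)
  then have "Im z = 0" "Re z \<le> 0"
    by (simp_all add: z Re_power2 Im_power2)
  moreover have "z \<noteq> 0"
  proof
    assume "z = 0"
    then show False
      using assms(1,3) by (simp add: matching_sum_0)
  qed
  ultimately show "Im z = 0" "Re z < 0"
    by (auto simp: complex_eq_iff)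
qed

section \<open>Factorization of the partition function over the reals\<close>

lemma matching_number_attained:
  assumes "finite E"
  obtains M where "M \<in> matchings E" and "card M = matching_number E"
proof -
  have "matching_number E \<in> card ` matchings E"
    unfolding matching_number_def
    using finite_matchings[OF assms] empty_in_matchings[of E] by (intro Max_in) auto
  then show thesis
    using that by auto
qed

lemma card_le_matching_number:
  assumes "finite E" and "M \<in> matchings E"
  shows "card M \<le> matching_number E"
  unfolding matching_number_def using finite_matchings[OF assms(1)] assms(2) by simp

text \<open>The coefficient of degree \<open>k\<close> of \<open>P\<close> counts the matchings of
  size \<open>k\<close>, so the degree is the matching number and the leading coefficient a positive
  integer. Over the complex numbers \<open>P\<close> splits, and the \<open>r i\<close> are its
  negated roots.\<close>

lemma partition_function_factorization:
  assumes fin: "finite E" and two: "\<And>e. e \<in> E \<Longrightarrow> card e = 2"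
  obtains c :: real and r :: "nat \<Rightarrow> real"
  where "c \<ge> 1" and "\<And>i. i < matching_number E \<Longrightarrow> r i > 0"
    and "\<And>l. partition_function E l = c * (\<Prod>i<matching_number E. l + r i)"
proof -
  define P :: "complex poly" where "P = (\<Sum>M\<in>matchings E. monom 1 (card M))"
  define n where "n = matching_number E"
  define m where "m = card {M \<in> matchings E. card M = n}"
  note finM = finite_matchings[OF fin]
  have poly_P: "poly P z = matching_sum E z" for z
    by (simp add: P_def matching_sum_def poly_sum poly_monom)
  have coeff_P: "coeff P k = of_nat (card {M \<in> matchings E. card M = k})" for k
    using finM by (simp add: P_def coeff_sum sum.If_cases Int_def)
  have "{M \<in> matchings E. card M = n} \<noteq> {}"
    using matching_number_attained[OF fin] unfolding n_def by blast
  then have m: "m \<ge> 1"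
    using finM by (simp add: m_def Suc_le_eq card_gt_0_iff)
  have deg: "degree P = n"
  proof (rule antisym)
    show "degree P \<le> n"
    proof (rule degree_le, intro allI impI)
      fix k assume "n < k"
      then have "{M \<in> matchings E. card M = k} = {}"
        using card_le_matching_number[OF fin] by (force simp: n_def)
      then show "coeff P k = 0"
        by (simp only: coeff_P) simp
    qed
    show "n \<le> degree P"
      using m by (intro le_degree) (simp add: coeff_P m_def)
  qed
  have "coeff P n \<noteq> 0"
    using m by (simp add: coeff_P m_def)
  then have "P \<noteq> 0" by auto
  then obtain A where "size A = degree P" and A: "P = smult (lead_coeff P) (\<Prod>x\<in>#A. [:-x, 1:])"
    using alg_closed_imp_factorization by blast
  \<comment> \<open>Listing the multiset of roots lets the product run over \<open>i < n\<close>,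
    with multiplicities kept.\<close>
  moreover obtain xs where "mset xs = A"
    using ex_mset by blast
  ultimately have len: "length xs = n"
    and P: "P = smult (of_nat m) (\<Prod>x\<in>#mset xs. [:-x, 1:])"
    using deg by (auto simp: coeff_P m_def)
  define r where "r = (\<lambda>i. - Re (xs ! i))"
  have prod: "poly P z = of_nat m * (\<Prod>i<n. z - xs ! i)" for z
  proof -
    have "poly P z = of_nat m * prod_list (map (\<lambda>x. z - x) xs)"
      unfolding P poly_smult poly_prod_mset
      by (simp add: prod_mset_prod_list flip: mset_map)
    also have "prod_list (map (\<lambda>x. z - x) xs) = (\<Prod>i<n. z - xs ! i)"
      using prod.distinct_set_conv_list[of "[0..<n]" "\<lambda>i. z - xs ! i"] map_nth[of xs] len
      by (simp add: atLeast0LessThan) (metis (no_types, lifting) comp_def map_eq_conv map_map)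
    finally show ?thesis .
  qed
  have root: "Im (xs ! i) = 0" "Re (xs ! i) < 0" if "i < n" for i
  proof -
    have "matching_sum E (xs ! i) = 0"
      using that by (auto simp: prod simp flip: poly_P)
    then show "Im (xs ! i) = 0" "Re (xs ! i) < 0"
      using matching_sum_root[OF fin two] by auto
  qed
  show thesis
  proof (rule that[of "real m" r])
    show "1 \<le> real m" using m by simp
    show "r i > 0" if "i < matching_number E" for i
      using root(2)[of i] that by (simp add: r_def n_def)
    show "partition_function E l = real m * (\<Prod>i<matching_number E. l + r i)" for l
    proof -
      \<comment> \<open>The identity is checked over the complex numbers, where the roots have
        imaginary part 0, and pulled back by injectivity of \<open>of_real\<close>.\<close>
      have "complex_of_real (partition_function E l) = poly P (of_real l)"
        by (simp add: poly_P partition_function_def matching_sum_def)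
      also have "\<dots> = of_nat m * (\<Prod>i<n. of_real (l + r i))"
        unfolding prod by (intro arg_cong2[of _ _ _ _ "(*)"] prod.cong)
          (auto simp: r_def root complex_eq_iff)
      also have "\<dots> = complex_of_real (real m * (\<Prod>i<n. l + r i))"
        by simp
      finally show ?thesis
        unfolding of_real_eq_iff n_def .
    qed
  qed
qed

section \<open>Logarithmic derivative and expected size\<close>

text \<open>For the empty matching truncated subtraction gives exponent 0; the factor
  \<open>card M\<close> removes that term.\<close>

lemma partition_function_deriv:
  assumes "finite E"
  shows "(partition_function E has_real_derivative
    (\<Sum>M\<in>matchings E. real (card M) * l ^ (card M - 1))) (at l)"
  unfolding partition_function_def[abs_def]
  by (auto intro!: derivative_eq_intros simp: mult.commute)

text \<open>Both sides are the derivative of the partition function at \<open>l\<close>. The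
  identity serves twice: at the given fugacity for the expected size, and at 0 for the sum of the
  \<open>1 / r i\<close>.\<close>

lemma partition_function_log_deriv:
  assumes "finite E" and "\<And>i. i < n \<Longrightarrow> l + r i \<noteq> 0"
    and eq: "\<And>l. partition_function E l = c * (\<Prod>i<n. l + r i)"
  shows "(\<Sum>M\<in>matchings E. real (card M) * l ^ (card M - 1))
    = partition_function E l * (\<Sum>i<n. 1 / (l + r i))"
proof -
  have "((\<lambda>l. \<Prod>i<n. l + r i) has_real_derivative (\<Prod>i<n. l + r i) * (\<Sum>i<n. 1 / (l + r i))) (at l)"
    using assms(2) by (intro has_field_derivative_prod') (auto intro!: derivative_eq_intros)
  then have "((\<lambda>l. c * (\<Prod>i<n. l + r i)) has_real_derivative
      c * ((\<Prod>i<n. l + r i) * (\<Sum>i<n. 1 / (l + r i)))) (at l)"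
    by (rule DERIV_cmult)
  moreover have "partition_function E = (\<lambda>l. c * (\<Prod>i<n. l + r i))"
    using eq by blast
  ultimately have "(partition_function E has_real_derivative
      partition_function E l * (\<Sum>i<n. 1 / (l + r i))) (at l)"
    by (simp add: mult.assoc)
  from DERIV_unique[OF partition_function_deriv[OF assms(1)] this] show ?thesis .
qed

lemma expectation_gibbs_card:
  assumes fin: "finite E" and "l > 0"
  shows "measure_pmf.expectation (gibbs E l) (\<lambda>M. real (card M))
    = l * (\<Sum>M\<in>matchings E. real (card M) * l ^ (card M - 1)) / partition_function E l"
proof -
  have "measure_pmf.expectation (gibbs E l) (\<lambda>M. real (card M))
      = (\<Sum>M\<in>matchings E. real (card M) * pmf (gibbs E l) M)"
    using finite_matchings[OF fin] pmf_gibbs[OF assms]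
    by (intro integral_measure_pmf_real) (auto simp: set_pmf_iff split: if_splits)
  also have "\<dots> = (\<Sum>M\<in>matchings E. l * (real (card M) * l ^ (card M - 1)) / partition_function E l)"
  proof (rule sum.cong[OF refl])
    fix M assume "M \<in> matchings E"
    then show "real (card M) * pmf (gibbs E l) M
        = l * (real (card M) * l ^ (card M - 1)) / partition_function E l"
      using pmf_gibbs[OF assms, of M] by (cases "card M") auto
  qed
  finally show ?thesis
    by (simp add: sum_distrib_left sum_divide_distrib)
qed

section \<open>The linear coefficient and the number of edges\<close>

text \<open>This is the derivative at 0: the power vanishes for two or more edges, the factor
  \<open>card M\<close> removes the empty matching, and each single edge contributes 1.\<close>

lemma sum_card_matchings_at_0:
  assumes "finite E"
  shows "(\<Sum>M\<in>matchings E. real (card M) * 0 ^ (card M - 1)) = real (card E)"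
proof -
  have "(\<Sum>M\<in>matchings E. real (card M) * 0 ^ (card M - 1))
      = (\<Sum>M\<in>(\<lambda>e. {e}) ` E. real (card M) * 0 ^ (card M - 1))"
  proof (rule sum.mono_neutral_right[OF finite_matchings[OF assms]])
    show "(\<lambda>e. {e}) ` E \<subseteq> matchings E"
      by (auto simp: matchings_def)
    show "\<forall>M\<in>matchings E - (\<lambda>e. {e}) ` E. real (card M) * 0 ^ (card M - 1) = 0"
    proof
      fix M assume M: "M \<in> matchings E - (\<lambda>e. {e}) ` E"
      have "card M \<noteq> 1"
        using M by (auto simp: card_1_singleton_iff matchings_def)
      then show "real (card M) * 0 ^ (card M - 1) = 0"
        by (cases "card M = 0") (auto simp: power_0_left)
    qed
  qed
  also have "\<dots> = real (card E)"
    by (subst sum.reindex) (auto simp: inj_on_def)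
  finally show ?thesis .
qed

text \<open>The endpoints of a maximum matching form a vertex cover.\<close>
lemma card_edges_le:
  assumes G: "simple_graph V E"
  shows "card E \<le> 2 * matching_number E * max_degree V E"
proof -
  have fin: "finite E" and V: "finite V" and sub: "\<And>e. e \<in> E \<Longrightarrow> e \<subseteq> V"
    and two: "\<And>e. e \<in> E \<Longrightarrow> card e = 2"
    using simple_graph_finite_edges[OF G] G by (auto simp: simple_graph_def)
  obtain M where M: "M \<in> matchings E" and cM: "card M = matching_number E"
    using matching_number_attained[OF fin] .
  have ME: "M \<subseteq> E" and finM: "finite M"
    using M fin finite_subset by (auto simp: matchings_def)
  have "\<Union>M \<subseteq> V"
    using ME sub by blast
  then have finU: "finite (\<Union>M)"
    using V by (rule finite_subset)
  have "E \<subseteq> (\<Union>v\<in>\<Union>M. {e \<in> E. v \<in> e})"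
  proof
    fix e assume e: "e \<in> E"
    have "e \<inter> \<Union>M \<noteq> {}"
    proof
      assume dis: "e \<inter> \<Union>M = {}"
      have "e \<noteq> {}"
        using two[OF e] by auto
      then have "e \<notin> M"
        using dis by auto
      moreover have "insert e M \<in> matchings E"
        using M e dis unfolding matchings_def disjoint_def by blast
      ultimately show False
        using card_le_matching_number[OF fin, of "insert e M"] cM finM by simp
    qed
    then show "e \<in> (\<Union>v\<in>\<Union>M. {e \<in> E. v \<in> e})"
      using e by blast
  qed
  then have "card E \<le> card (\<Union>v\<in>\<Union>M. {e \<in> E. v \<in> e})"
    using fin by (intro card_mono) (auto intro: rev_finite_subset)
  also have "\<dots> \<le> (\<Sum>v\<in>\<Union>M. card {e \<in> E. v \<in> e})"
    by (rule card_UN_le[OF finU])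
  also have "\<dots> \<le> (\<Sum>v\<in>\<Union>M. max_degree V E)"
    using V \<open>\<Union>M \<subseteq> V\<close>
    by (intro sum_mono) (auto simp: max_degree_def vertex_degree_def intro!: Max_ge)
  also have "\<dots> = card (\<Union>M) * max_degree V E"
    by simp
  also have "card (\<Union>M) \<le> (\<Sum>e\<in>M. card e)"
    by (rule card_Union_le_sum_card)
  also have "(\<Sum>e\<in>M. card e) = 2 * matching_number E"
    using two ME cM by (simp add: subset_iff)
  finally show ?thesis
    by simp
qed

section \<open>Counting small factors of a product\<close>

text \<open>For positive \<open>x\<close>, the bound \<open>1 + t <= exp t\<close> at
  \<open>t = x * ln 2 - 1\<close> yields \<open>exp 1 * ln 2 * x <= 2 powr x\<close>; the crude
  estimates 2 for \<open>exp 1\<close> and 1/2 for \<open>ln 2\<close> make the coefficient at least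
  1.\<close>

lemma le_two_powr:
  fixes x :: real
  shows "x \<le> 2 powr x"
proof (cases "x > 0")
  case True
  have e: "exp 1 \<ge> (2::real)"
    using exp_ge_add_one_self[of 1] by simp
  have "ln (inverse 2 :: real) \<le> inverse 2 - 1"
    by (rule ln_le_minus_one) simp
  then have ln2: "ln 2 \<ge> (1 / 2 :: real)"
    using ln_inverse[of "2::real"] unfolding inverse_eq_divide by linarith
  have "1 * x \<le> (exp 1 * ln 2) * x"
    using mult_mono[OF e ln2] True by (intro mult_right_mono) auto
  also have "\<dots> = exp 1 * (1 + (x * ln 2 - 1))"
    by simp
  also have "\<dots> \<le> exp 1 * exp (x * ln 2 - 1)"
    by (intro mult_left_mono exp_ge_add_one_self) auto
  also have "\<dots> = 2 powr x"
    by (simp add: powr_def flip: exp_add)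
  finally show ?thesis by simp
next
  case False
  then show ?thesis
    using powr_ge_zero[of 2 x] by linarith
qed

text \<open>
  The bound \<open>x\<^sub>i / (2D) \<le> 2 powr (x\<^sub>i / (2D))\<close> replaces the AM-GM inequality: it shows that the
  product of any \<open>g\<close> of the numbers is at most \<open>(2D)^g * 2^n\<close>.
\<close>
lemma card_small_factors_le:
  fixes x :: "nat \<Rightarrow> real" and D \<epsilon> :: real
  assumes pos: "\<And>i. i < n \<Longrightarrow> x i > 0" and prod: "(\<Prod>i<n. x i) \<ge> 1"
    and sum: "(\<Sum>i<n. x i) \<le> 2 * D * n" and D: "D \<ge> 1" and eps: "\<epsilon> > 0"
  shows "card {i. i < n \<and> x i < 1 / (4 * D) powr (2 / \<epsilon>)} \<le> \<epsilon> / 2 * n"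
proof (rule ccontr)
  define C where "C = (4 * D) powr (2 / \<epsilon>)"
  define B where "B = {i. i < n \<and> x i < 1 / C}"
  define H where "H = {..<n} - B"
  assume "\<not> card {i. i < n \<and> x i < 1 / (4 * D) powr (2 / \<epsilon>)} \<le> \<epsilon> / 2 * n"
  then have b: "real (card B) > \<epsilon> / 2 * n"
    by (simp add: B_def C_def)
  have C: "C > 0"
    using D by (simp add: C_def)
  have B: "B \<subseteq> {..<n}"
    by (auto simp: B_def)
  have "(\<Prod>i\<in>H. x i) \<le> (\<Prod>i\<in>H. 2 * D * 2 powr (x i / (2 * D)))"
  proof (rule prod_mono)
    fix i assume "i \<in> H"
    then show "0 \<le> x i \<and> x i \<le> 2 * D * 2 powr (x i / (2 * D))"
      using pos[of i] le_two_powr[of "x i / (2 * D)"] D by (auto simp: H_def field_simps)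
  qed
  also have "\<dots> = (2 * D) ^ card H * 2 powr ((\<Sum>i\<in>H. x i) / (2 * D))"
    by (simp add: prod.distrib powr_sum sum_divide_distrib H_def)
  \<comment> \<open>The bound \<open>2 * D * n\<close> on the sum makes the exponent at most
    \<open>n\<close>, and \<open>2 * D >= 1\<close> allows raising \<open>card H\<close> to
    \<open>n\<close>.\<close>
  also have "\<dots> \<le> (2 * D) ^ n * 2 powr n"
  proof (intro mult_mono power_increasing)
    show "card H \<le> n"
      using card_mono[of "{..<n}" H] by (auto simp: H_def)
    have "(\<Sum>i\<in>H. x i) \<le> (\<Sum>i<n. x i)"
      using pos by (intro sum_mono2) (auto simp: H_def less_imp_le)
    then show "2 powr ((\<Sum>i\<in>H. x i) / (2 * D)) \<le> 2 powr n"
      using sum D by (intro powr_mono) (auto simp: field_simps)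
  qed (use D in auto)
  also have "\<dots> = (4 * D) powr n"
    using D power_mult_distrib[of "2 * D" 2 n] by (simp add: powr_realpow mult.commute)
  finally have H: "(\<Prod>i\<in>H. x i) \<le> (4 * D) powr n" .
  have "(\<Prod>i\<in>B. x i) \<le> (\<Prod>i\<in>B. 1 / C)"
    using pos by (intro prod_mono) (auto simp: B_def less_imp_le)
  also have "\<dots> = C powr (- real (card B))"
    using C by (simp add: powr_minus powr_realpow power_one_over inverse_eq_divide)
  also have "\<dots> = (4 * D) powr (- (2 / \<epsilon> * card B))"
    by (simp add: C_def powr_powr)
  \<comment> \<open>The exponent in \<open>C\<close> is chosen for this: \<open>b\<close> says
    exactly that \<open>2 / \<epsilon> * card B\<close> exceeds \<open>n\<close>.\<close>
  also have "\<dots> < (4 * D) powr (- real n)"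
    using D b eps by (intro powr_less_mono) (auto simp: field_simps)
  finally have B': "(\<Prod>i\<in>B. x i) < (4 * D) powr (- real n)" .
  have "(\<Prod>i<n. x i) = (\<Prod>i\<in>H. x i) * (\<Prod>i\<in>B. x i)"
    unfolding H_def by (rule prod.subset_diff[OF B]) simp
  also have "\<dots> \<le> (4 * D) powr n * (\<Prod>i\<in>B. x i)"
    using H pos by (intro mult_right_mono prod_nonneg) (auto simp: B_def less_imp_le)
  also have "\<dots> < (4 * D) powr n * (4 * D) powr (- real n)"
    using B' D by (intro mult_strict_left_mono) auto
  also have "\<dots> = 1"
    using D by (simp flip: powr_add)
  finally show False
    using prod by simp
qed

section \<open>The lower bound on the expected size\<close>

lemma expectation_gibbs_card_ge:
  assumes G: "simple_graph V E" and "\<epsilon> > 0" and l: "l > 0"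
  shows "(1 - \<epsilon> / 2) * l / (l + (4 * real (max_degree V E)) powr (2 / \<epsilon>)) * real (matching_number E)
    \<le> measure_pmf.expectation (gibbs E l) (\<lambda>M. real (card M))"
proof (cases "max_degree V E = 0 \<or> matching_number E = 0")
  case True
  \<comment> \<open>Either zero makes the bound of \<open>card_edges_le\<close> zero; without edges
    the claimed lower bound is 0. The other case has \<open>D >= 1\<close>.\<close>
  then have "E = {}"
    using card_edges_le[OF G] simple_graph_finite_edges[OF G] by auto
  then have "matching_number E = 0"
    by (simp add: matching_number_def matchings_def)
  then show ?thesis by simp
next
  case False
  define n where "n = matching_number E"
  define D where "D = real (max_degree V E)"
  define C where "C = (4 * D) powr (2 / \<epsilon>)"
  have fin: "finite E" and two: "\<And>e. e \<in> E \<Longrightarrow> card e = 2"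
    using simple_graph_finite_edges[OF G] G by (auto simp: simple_graph_def)
  obtain c r where c: "c \<ge> 1" and r: "\<And>i. i < n \<Longrightarrow> r i > 0"
    and eq: "\<And>l. partition_function E l = c * (\<Prod>i<n. l + r i)"
    using partition_function_factorization[OF fin two] unfolding n_def by metis
  have D: "D \<ge> 1" and C: "C > 0"
    using False by (auto simp: D_def C_def)
  have Z0: "partition_function E 0 = 1"
    using matching_sum_0[OF fin, where 'b = real]
    by (simp add: partition_function_def matching_sum_def)
  \<comment> \<open>The indices with \<open>r i > C\<close>, phrased through reciprocals to fit
    \<open>card_small_factors_le\<close>.\<close>
  let ?B = "{i. i < n \<and> 1 / r i < 1 / C}"
  have "real (card ?B) \<le> \<epsilon> / 2 * n"
    unfolding C_def
  proof (rule card_small_factors_le)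
    have "1 = c * (\<Prod>i<n. r i)"
      using Z0 eq[of 0] by simp
    then show "(\<Prod>i<n. 1 / r i) \<ge> 1"
      using c by (simp add: prod_dividef) (smt (verit) nonzero_eq_divide_eq mult_not_zero)
    \<comment> \<open>The logarithmic derivative at 0, where the partition function is 1.\<close>
    have "(\<Sum>i<n. 1 / r i) = real (card E)"
      using partition_function_log_deriv[OF fin _ eq, of 0] r Z0
        sum_card_matchings_at_0[OF fin] by force
    also have "\<dots> \<le> real (2 * matching_number E * max_degree V E)"
      using card_edges_le[OF G] by (simp only: of_nat_le_iff)
    finally show "(\<Sum>i<n. 1 / r i) \<le> 2 * D * n"
      by (simp add: n_def D_def mult_ac)
  qed (use r D \<open>\<epsilon> > 0\<close> in auto)
  moreover have "card ({..<n} - ?B) = n - card ?B" "card ?B \<le> n"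
    using card_mono[of "{..<n}" ?B] card_Diff_subset[of ?B "{..<n}"] by auto
  ultimately have good: "(1 - \<epsilon> / 2) * n \<le> card ({..<n} - ?B)"
    by (simp add: algebra_simps of_nat_diff)
  have "(1 - \<epsilon> / 2) * n * (l / (l + C)) \<le> card ({..<n} - ?B) * (l / (l + C))"
    using good l C by (intro mult_right_mono) auto
  also have "\<dots> = (\<Sum>i\<in>{..<n} - ?B. l / (l + C))"
    by simp
  also have "\<dots> \<le> (\<Sum>i\<in>{..<n} - ?B. l / (l + r i))"
  proof (rule sum_mono)
    fix i assume "i \<in> {..<n} - ?B"
    then have "0 < r i" "r i \<le> C"
      using r C by (auto simp: field_simps not_less)
    then show "l / (l + C) \<le> l / (l + r i)"
      using l by (intro divide_left_mono) auto
  qed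
  also have "\<dots> \<le> (\<Sum>i<n. l / (l + r i))"
    using l r by (intro sum_mono2) (auto simp: less_imp_le add_pos_pos)
  also have "\<dots> = l * (\<Sum>i<n. 1 / (l + r i))"
    by (simp add: sum_distrib_left)
  also have "\<dots> = measure_pmf.expectation (gibbs E l) (\<lambda>M. real (card M))"
  proof -
    have "l + r i \<noteq> 0" if "i < n" for i
      using r[OF that] l by simp
    from partition_function_log_deriv[OF fin this eq] show ?thesis
      using partition_function_pos[OF fin l] by (simp add: expectation_gibbs_card[OF fin l])
  qed
  finally show ?thesis
    by (simp add: n_def D_def C_def mult_ac)
qed

theorem theorem3p1:
  fixes V :: "'a set" and E :: "'a set set" and \<Delta> :: nat and \<epsilon> l :: real
  assumes "simple_graph V E"
    and "\<Delta> = max_degree V E"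
    and "\<epsilon> > 0"
    and "l > 0"
  shows "measure_pmf.expectation (gibbs E l) (\<lambda>M. real (card M))
           \<ge> (1 - \<epsilon> / 2) * l / (l + (4 * real \<Delta>) powr (2 / \<epsilon>)) * real (matching_number E)
       \<and> (l \<ge> 2 / \<epsilon> * (4 * real \<Delta>) powr (2 / \<epsilon>) \<longrightarrow>
            measure_pmf.expectation (gibbs E l) (\<lambda>M. real (card M))
              \<ge> (1 - \<epsilon> / 2) / (1 + \<epsilon> / 2) * real (matching_number E)
          \<and> (1 - \<epsilon> / 2) / (1 + \<epsilon> / 2) * real (matching_number E)
              \<ge> (1 - \<epsilon>) * real (matching_number E))"
proof (intro conjI impI)
  let ?\<mu> = "measure_pmf.expectation (gibbs E l) (\<lambda>M. real (card M))"
  define C where "C = (4 * real \<Delta>) powr (2 / \<epsilon>)"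
  have C: "C \<ge> 0"
    by (simp add: C_def)
  have ge: "(1 - \<epsilon> / 2) * l / (l + C) * real (matching_number E) \<le> ?\<mu>"
    unfolding C_def assms(2) using expectation_gibbs_card_ge[OF assms(1,3,4)] .
  then show "(1 - \<epsilon> / 2) * l / (l + (4 * real \<Delta>) powr (2 / \<epsilon>)) * real (matching_number E) \<le> ?\<mu>"
    by (simp only: C_def)
  assume large: "2 / \<epsilon> * (4 * real \<Delta>) powr (2 / \<epsilon>) \<le> l"
  show "(1 - \<epsilon> / 2) / (1 + \<epsilon> / 2) * real (matching_number E) \<le> ?\<mu>"
  \<comment> \<open>Multiplying by \<open>1 - \<epsilon> / 2\<close> preserves the inequality only
    if this factor is nonnegative; otherwise the claimed bound is at most 0.\<close>
  proof (cases "\<epsilon> \<le> 2")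
    case True
    have "C \<le> \<epsilon> / 2 * l"
      using large assms(3) by (simp add: C_def field_simps)
    then have "1 / (1 + \<epsilon> / 2) \<le> l / (l + C)"
      using assms(3,4) C by (simp add: field_simps add_pos_nonneg)
    then have "(1 - \<epsilon> / 2) * (1 / (1 + \<epsilon> / 2)) * real (matching_number E)
        \<le> (1 - \<epsilon> / 2) * (l / (l + C)) * real (matching_number E)"
      using True by (intro mult_right_mono mult_left_mono) auto
    then show ?thesis
      using ge by simp
  next
    case False
    then have "(1 - \<epsilon> / 2) / (1 + \<epsilon> / 2) \<le> 0"
      by (intro divide_nonpos_pos) auto
    then have "(1 - \<epsilon> / 2) / (1 + \<epsilon> / 2) * real (matching_number E) \<le> 0"
      by (intro mult_nonpos_nonneg) auto
    also have "0 \<le> ?\<mu>"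
      by simp
    finally show ?thesis .
  qed
  show "(1 - \<epsilon>) * real (matching_number E) \<le> (1 - \<epsilon> / 2) / (1 + \<epsilon> / 2) * real (matching_number E)"
  proof (rule mult_right_mono)
    \<comment> \<open>Clearing the denominator:
      \<open>(1 - \<epsilon>) * (1 + \<epsilon> / 2)\<close> falls short of
      \<open>1 - \<epsilon> / 2\<close> by half the square of \<open>\<epsilon>\<close>.\<close>
    show "1 - \<epsilon> \<le> (1 - \<epsilon> / 2) / (1 + \<epsilon> / 2)"
      using assms(3) by (simp add: field_simps)
  qed simp
qed

end
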